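(* For every real number $x$ and every integer $g\geq 2$, there exists a basic sequence $Q = (q_n)_{n=1}^\infty$ with $q_n = g^{k_n}$ for some sequence of natural numbers $(k_n)$ such that $x \notin \mathscr{N}(Q) \cup \mathscr{DN}(Q)$. Thus, for every integer $g\ge 2$, there exists a basic sequence $Q = (q_n)_{n=1}^\infty$ with $q_n = g^{k_n}$ for some sequence of natural numbers $(k_n)$ such that $\mathscr{N}(g) \neq \mathscr{N}(Q)$ and $\mathscr{N}(g) \neq \mathscr{DN}(Q)$.
   Context: A basic sequence is a sequence $Q=(q_n)_{n=1}^\infty$ of integers $q_n\ge 2$ (so above each $k_n\ge 1$). The $Q$-Cantor series expansion of a real number $x$ is the unique expansion $x=E_0+\sum_{n=1}^\infty \frac{E_n}{q_1q_2\cdots q_n}$ with $E_0=\lfloor x\rfloor$ and $E_n\in\{0,1,\ldots,q_n-1\}$ for $n\ge1$, with $E_n\ne q_n-1$ for infinitely many $n$. A block is a finite tuple $B=(b_1,\ldots,b_k)$ of non-negative integers. For a natural number $j\ge 1$ let $\mathcal{I}_{Q,j}(B)=1$ if $b_1<q_j,\ b_2<q_{j+1},\ \ldots,\ b_k<q_{j+k-1}$, and $\mathcal{I}_{Q,j}(B)=0$ otherwise. Let $Q_n(B)=\sum_{j=1}^n \frac{\mathcal{I}_{Q,j}(B)}{q_jq_{j+1}\cdots q_{j+k-1}}$. Let $N_n^Q(B,x)$ be the number of occurrences of the block $B$ (as consecutive digits) in the sequence $(E_i)_{i=1}^n$ of the first $n$ digits of the $Q$-Cantor series expansion of $x$. A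 real number $x$ is $Q$-normal if for all blocks $B$ such that $\lim_{n\to\infty}Q_n(B)=\infty$ we have $\lim_{n\to\infty}\frac{N_n^Q(B,x)}{Q_n(B)}=1$. $\mathscr{N}(Q)$ denotes the set of $Q$-normal real numbers. Let $T_{Q,n}(x)=q_nq_{n-1}\cdots q_1x \pmod 1$ (with $T_{Q,0}(x)=x \bmod 1$). A real number $x$ is $Q$-distribution normal if the sequence $(T_{Q,n}(x))_{n=0}^\infty$ is uniformly distributed mod $1$. $\mathscr{DN}(Q)$ denotes the set of $Q$-distribution normal real numbers. For an integer $g\ge2$, $\mathscr{N}(g)$ denotes the set of real numbers normal in base $g$ in the usual sense; equivalently, those $x$ for which $(g^nx)_{n=0}^\infty$ is uniformly distributed mod $1$. *)

theory Defs
  imports Complex_Main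
begin

text \<open>
  Sequences written $(q_n)_{n \ge 1}$ are functions on \<^typ>\<open>nat\<close> whose value at \<open>0\<close> is
  never used.
\<close>

definition basic_sequence :: "(nat \<Rightarrow> nat) \<Rightarrow> bool" where
  "basic_sequence Q \<longleftrightarrow> (\<forall>n\<ge>1. Q n \<ge> 2)"

definition is_cantor_expansion :: "(nat \<Rightarrow> nat) \<Rightarrow> real \<Rightarrow> (nat \<Rightarrow> int) \<Rightarrow> bool" where
  "is_cantor_expansion Q x E \<longleftrightarrow>
     E 0 = \<lfloor>x\<rfloor> \<and>
     (\<forall>n\<ge>1. 0 \<le> E n \<and> E n \<le> int (Q n) - 1) \<and>
     infinite {n. n \<ge> 1 \<and> E n \<noteq> int (Q n) - 1} \<and>
     (\<lambda>n. real_of_int (E (Suc n)) / real (\<Prod>i=1..Suc n. Q i)) sums (x - real_of_int (E 0))"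

text \<open>Well defined for every basic sequence; see \<open>cantor_expansion_ex1\<close> below.\<close>

definition cantor_digits :: "(nat \<Rightarrow> nat) \<Rightarrow> real \<Rightarrow> nat \<Rightarrow> int" where
  "cantor_digits Q x = (THE E. is_cantor_expansion Q x E)"

text \<open>
  A block $(b_1, \ldots, b_k)$ is a list of naturals; $b_{i+1}$ is \<open>B ! i\<close>.
\<close>

definition block_admissible :: "(nat \<Rightarrow> nat) \<Rightarrow> nat \<Rightarrow> nat list \<Rightarrow> bool" where
  "block_admissible Q j B \<longleftrightarrow> (\<forall>i<length B. B ! i < Q (j + i))"

definition block_weight :: "(nat \<Rightarrow> nat) \<Rightarrow> nat \<Rightarrow> nat list \<Rightarrow> real" where
  "block_weight Q n B =
     (\<Sum>j=1..n. of_bool (block_admissible Q j B) / real (\<Prod>i=j..<j + length B. Q i))"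

text \<open>
  Occurrences are counted by starting position \<open>j\<close>, may overlap, and must lie entirely within
  $E_1, \ldots, E_n$; the integer part $E_0$ is not a digit.
\<close>

definition block_count :: "(nat \<Rightarrow> nat) \<Rightarrow> nat \<Rightarrow> nat list \<Rightarrow> real \<Rightarrow> nat" where
  "block_count Q n B x =
     card {j. 1 \<le> j \<and> j + length B \<le> n + 1 \<and>
              (\<forall>i<length B. cantor_digits Q x (j + i) = int (B ! i))}"

definition Q_normal :: "(nat \<Rightarrow> nat) \<Rightarrow> real set" where
  "Q_normal Q =
     {x. \<forall>B. B \<noteq> [] \<longrightarrow> filterlim (\<lambda>n. block_weight Q n B) at_top sequentially \<longrightarrow>
             (\<lambda>n. real (block_count Q n B x) / block_weight Q n B) \<longlonglongrightarrow> 1}"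

definition uniformly_distributed_mod1 :: "(nat \<Rightarrow> real) \<Rightarrow> bool" where
  "uniformly_distributed_mod1 s \<longleftrightarrow>
     (\<forall>a b. 0 \<le> a \<and> a < b \<and> b \<le> 1 \<longrightarrow>
        (\<lambda>N. real (card {n. n < N \<and> frac (s n) \<in> {a..<b}}) / real N) \<longlonglongrightarrow> b - a)"

definition cantor_shift :: "(nat \<Rightarrow> nat) \<Rightarrow> nat \<Rightarrow> real \<Rightarrow> real" where
  "cantor_shift Q n x = frac (real (\<Prod>i=1..n. Q i) * x)"

definition Q_distribution_normal :: "(nat \<Rightarrow> nat) \<Rightarrow> real set" where
  "Q_distribution_normal Q = {x. uniformly_distributed_mod1 (\<lambda>n. cantor_shift Q n x)}"

text \<open>
  Normality in base \<open>g\<close> in the usual sense: every block of length \<open>k\<close> over the digits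
  $0, \ldots, g - 1$ has asymptotic frequency $g^{-k}$. The base-\<open>g\<close> expansion is the Cantor
  expansion for the constant sequence \<open>g\<close>.
\<close>

definition base_normal :: "nat \<Rightarrow> real set" where
  "base_normal g =
     {x. \<forall>B. B \<noteq> [] \<longrightarrow> (\<forall>b\<in>set B. b < g) \<longrightarrow>
             (\<lambda>n. real (block_count (\<lambda>_. g) n B x) / real n) \<longlonglongrightarrow> 1 / real g ^ length B}"

lemma cantor_expansion_floor:
  assumes Q: "basic_sequence Q" and E: "is_cantor_expansion Q x E" and n: "n \<ge> 1"
  shows "E n = \<lfloor>real (\<Prod>i=1..n. Q i) * x\<rfloor> - int (Q n) * \<lfloor>real (\<Prod>i=1..n - 1. Q i) * x\<rfloor>"
proof -
  define P where "P m = (\<Prod>i=1..m. Q i)" for m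
  have PS: "P (Suc m) = P m * Q (Suc m)" for m unfolding P_def by simp
  have q2: "Q (Suc m) \<ge> 2" for m using Q unfolding basic_sequence_def by simp
  have Ppos: "P m > 0" for m
  proof (induction m)
    case 0 then show ?case by (simp add: P_def)
  next
    case (Suc m) then show ?case using q2[of m] by (simp add: PS)
  qed
  have Pge: "real (P m) \<ge> 2 ^ m" for m
  proof (induction m)
    case 0 then show ?case by (simp add: P_def)
  next
    case (Suc m)
    have "2 ^ m * 2 \<le> real (P m) * real (Q (Suc m))"
      using Suc q2[of m] by (intro mult_mono) auto
    then show ?case by (simp add: PS mult.commute)
  qed
  have dig: "0 \<le> E (Suc m)" "E (Suc m) \<le> int (Q (Suc m)) - 1" for m
    using E unfolding is_cantor_expansion_def by auto
  define a where "a m = real_of_int (E (Suc m)) / real (P (Suc m))" for m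
  have sums: "a sums (x - real_of_int (E 0))"
    using E unfolding is_cantor_expansion_def a_def P_def by blast
  have P0: "(\<lambda>m. 1 / real (P m)) \<longlonglongrightarrow> 0"
  proof (rule tendsto_sandwich[of "\<lambda>_. 0" _ _ "\<lambda>m. (1 / 2) ^ m"])
    show "\<forall>\<^sub>F m in sequentially. 1 / real (P m) \<le> (1 / 2) ^ m"
      using Pge by (intro always_eventually allI) (simp add: power_one_over frac_le)
    show "(\<lambda>m. (1 / 2 :: real) ^ m) \<longlonglongrightarrow> 0" by (rule LIMSEQ_power_zero) simp
  qed auto
  define b where "b m = 1 / real (P m) - 1 / real (P (Suc m))" for m
  have bsums: "(\<lambda>j. b (j + m)) sums (1 / real (P m))" for m
  proof -
    have "(\<lambda>j. 1 / real (P (j + m))) \<longlonglongrightarrow> 0"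
      using LIMSEQ_ignore_initial_segment[OF P0] .
    from telescope_sums'[OF this] show ?thesis by (simp add: b_def)
  qed
  have b_eq: "b m = (real (Q (Suc m)) - 1) / real (P (Suc m))" for m
    using Ppos[of m] q2[of m] unfolding b_def PS by (simp add: field_simps)
  have ab: "0 \<le> a m" "a m \<le> b m" for m
  proof -
    show "0 \<le> a m" unfolding a_def using dig(1)[of m] by simp
    have "real_of_int (E (Suc m)) \<le> real (Q (Suc m)) - 1" using dig(2)[of m] by linarith
    then show "a m \<le> b m" unfolding a_def b_eq by (intro divide_right_mono) auto
  qed
  define S where "S m = (\<Sum>j<m. a j)" for m
  have tail: "(\<lambda>j. a (j + m)) sums (x - real_of_int (E 0) - S m)" for m
    using sums_split_initial_segment[OF sums, of m] by (simp add: S_def)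
  have tail_ge: "0 \<le> x - real_of_int (E 0) - S m" for m
    using sums_le[OF _ sums_zero tail[of m]] ab by blast
  have tail_lt: "x - real_of_int (E 0) - S m < 1 / real (P m)" for m
  proof -
    have "infinite {n. n \<ge> 1 \<and> E n \<noteq> int (Q n) - 1}"
      using E unfolding is_cantor_expansion_def by blast
    then have "\<exists>k>m. k \<in> {n. n \<ge> 1 \<and> E n \<noteq> int (Q n) - 1}"
      unfolding finite_nat_set_iff_bounded_le by (meson not_le)
    then have "\<exists>k\<ge>Suc m. E k \<noteq> int (Q k) - 1" by (auto simp: Suc_le_eq)
    then obtain k where k: "k \<ge> Suc m" "E k \<noteq> int (Q k) - 1" by blast
    define l where "l = k - Suc m"
    have kl: "k = Suc (l + m)" using k by (simp add: l_def)
    have "E (Suc (l + m)) < int (Q (Suc (l + m))) - 1" using dig(2)[of "l + m"] k kl by simp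
    then have "real_of_int (E (Suc (l + m))) < real (Q (Suc (l + m))) - 1" by linarith
    then have lt: "a (l + m) < b (l + m)"
      unfolding a_def b_eq using Ppos[of "Suc (l + m)"] by (intro divide_strict_right_mono) auto
    have d: "(\<lambda>j. b (j + m) - a (j + m)) sums (1 / real (P m) - (x - real_of_int (E 0) - S m))"
      by (intro sums_diff bsums tail)
    have "0 < (\<Sum>j. b (j + m) - a (j + m))"
      using ab lt by (intro suminf_pos2[OF sums_summable[OF d], of l]) (auto simp: algebra_simps)
    then show ?thesis using sums_unique[OF d] by simp
  qed
  have int: "\<exists>z::int. real (P m) * (real_of_int (E 0) + S m) = real_of_int z" for m
  proof (induction m)
    case 0
    show ?case by (simp add: P_def S_def)
  next
    case (Suc m)
    then obtain z :: int where z: "real (P m) * (real_of_int (E 0) + S m) = real_of_int z" by blast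
    have "real (P (Suc m)) * (real_of_int (E 0) + S (Suc m))
          = real (Q (Suc m)) * (real (P m) * (real_of_int (E 0) + S m)) + real_of_int (E (Suc m))"
      using Ppos[of "Suc m"] unfolding S_def a_def by (simp add: PS field_simps)
    also have "\<dots> = real_of_int (int (Q (Suc m)) * z + E (Suc m))" by (simp add: z)
    finally show ?case by blast
  qed
  have fl: "real (P m) * (real_of_int (E 0) + S m) = real_of_int \<lfloor>real (P m) * x\<rfloor>" for m
  proof -
    obtain z :: int where z: "real (P m) * (real_of_int (E 0) + S m) = real_of_int z"
      using int by blast
    have pos: "real (P m) > 0" using Ppos by simp
    have "0 \<le> real (P m) * (x - real_of_int (E 0) - S m)" using tail_ge pos by simp
    moreover have "real (P m) * (x - real_of_int (E 0) - S m) < 1"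
      using mult_strict_left_mono[OF tail_lt[of m] pos] pos by simp
    ultimately have "\<lfloor>real (P m) * x\<rfloor> = z"
      using z by (intro floor_unique) (simp_all add: algebra_simps)
    then show ?thesis using z by simp
  qed
  obtain m where m: "n = Suc m" using n by (cases n) auto
  have "real (P (Suc m)) * (real_of_int (E 0) + S (Suc m))
          = real (Q (Suc m)) * (real (P m) * (real_of_int (E 0) + S m)) + real_of_int (E (Suc m))"
    using Ppos[of "Suc m"] unfolding S_def a_def by (simp add: PS field_simps)
  then have "real_of_int \<lfloor>real (P (Suc m)) * x\<rfloor> =
      real_of_int (int (Q (Suc m)) * \<lfloor>real (P m) * x\<rfloor> + E (Suc m))"
    unfolding fl by simp
  then have "\<lfloor>real (P (Suc m)) * x\<rfloor> = int (Q (Suc m)) * \<lfloor>real (P m) * x\<rfloor> + E (Suc m)"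
    by linarith
  then show ?thesis unfolding m P_def by simp
qed

lemma cantor_expansion_exists:
  assumes Q: "basic_sequence Q"
  shows "\<exists>E. is_cantor_expansion Q x E"
proof -
  define P where "P m = (\<Prod>i=1..m. Q i)" for m
  have PS: "P (Suc m) = P m * Q (Suc m)" for m unfolding P_def by simp
  have q2: "Q (Suc m) \<ge> 2" for m using Q unfolding basic_sequence_def by simp
  have Ppos: "P m > 0" for m
  proof (induction m)
    case 0 then show ?case by (simp add: P_def)
  next
    case (Suc m) then show ?case using q2[of m] by (simp add: PS)
  qed
  have Pge: "real (P m) \<ge> 2 ^ m" for m
  proof (induction m)
    case 0 then show ?case by (simp add: P_def)
  next
    case (Suc m)
    have "2 ^ m * 2 \<le> real (P m) * real (Q (Suc m))"
      using Suc q2[of m] by (intro mult_mono) auto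
    then show ?case by (simp add: PS mult.commute)
  qed
  define F where "F m = \<lfloor>real (P m) * x\<rfloor>" for m
  define t where "t m = frac (real (P m) * x)" for m
  have t01: "0 \<le> t m" "t m < 1" for m unfolding t_def by (simp_all add: frac_lt_1)
  have xt: "real (P m) * x = real_of_int (F m) + t m" for m
    unfolding F_def t_def frac_def by simp
  define E where "E n = (if n = 0 then \<lfloor>x\<rfloor> else F n - int (Q n) * F (n - 1))" for n
  have ES: "real_of_int (E (Suc m)) = real (Q (Suc m)) * t m - t (Suc m)" for m
  proof -
    have "real (P (Suc m)) * x = real (Q (Suc m)) * (real (P m) * x)" by (simp add: PS)
    then have "real_of_int (F (Suc m)) + t (Suc m)
        = real (Q (Suc m)) * (real_of_int (F m) + t m)" by (simp only: xt)
    then show ?thesis unfolding E_def by (simp add: algebra_simps)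
  qed
  have dig: "0 \<le> E (Suc m) \<and> E (Suc m) \<le> int (Q (Suc m)) - 1" for m
  proof -
    have "0 \<le> real (Q (Suc m)) * t m" using t01 by simp
    then have "real_of_int (E (Suc m)) > -1" using t01(2)[of "Suc m"] ES[of m] by linarith
    moreover have "real (Q (Suc m)) * t m < real (Q (Suc m)) * 1"
      using t01(2)[of m] q2[of m] by (intro mult_strict_left_mono) auto
    then have "real_of_int (E (Suc m)) < real (Q (Suc m))"
      using t01(1)[of "Suc m"] ES[of m] by linarith
    ultimately show ?thesis by linarith
  qed
  have inf: "infinite {n. n \<ge> 1 \<and> E n \<noteq> int (Q n) - 1}"
  proof
    assume "finite {n. n \<ge> 1 \<and> E n \<noteq> int (Q n) - 1}"
    then obtain M where M: "\<forall>n \<in> {n. n \<ge> 1 \<and> E n \<noteq> int (Q n) - 1}. n < M"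
      using finite_nat_set_iff_bounded by blast
    then have mx: "E (Suc n) = int (Q (Suc n)) - 1" if "n \<ge> M" for n
      using that by (metis (mono_tags, lifting) le_SucI linorder_not_less mem_Collect_eq
          le_add1 plus_1_eq_Suc)
    have st: "1 - t (Suc n) = real (Q (Suc n)) * (1 - t n)" if "n \<ge> M" for n
      using ES[of n] mx[OF that] by (simp add: algebra_simps)
    have grow: "1 - t (M + j) \<ge> 2 ^ j * (1 - t M)" for j
    proof (induction j)
      case 0 then show ?case by simp
    next
      case (Suc j)
      have "2 * (1 - t (M + j)) \<le> real (Q (Suc (M + j))) * (1 - t (M + j))"
        using q2[of "M + j"] t01(2)[of "M + j"] by (intro mult_right_mono) auto
      then show ?case using Suc st[of "M + j"] by simp
    qed
    have pos: "1 - t M > 0" using t01 by simp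
    obtain j where "2 ^ j > 1 / (1 - t M)" using real_arch_pow[of 2 "1 / (1 - t M)"] by auto
    then have "2 ^ j * (1 - t M) > 1" using pos by (simp add: field_simps)
    then show False using grow[of j] t01(1)[of "M + j"] by linarith
  qed
  have part: "(\<Sum>j<m. real_of_int (E (Suc j)) / real (P (Suc j)))
      = t 0 - t m / real (P m)" for m
  proof (induction m)
    case 0 then show ?case by (simp add: P_def)
  next
    case (Suc m)
    have "real_of_int (E (Suc m)) / real (P (Suc m)) = t m / real (P m) - t (Suc m) / real (P (Suc m))"
      using Ppos[of m] q2[of m] unfolding ES by (simp add: PS field_simps)
    then show ?case using Suc by simp
  qed
  have lim: "(\<lambda>m. t m / real (P m)) \<longlonglongrightarrow> 0"
  proof (rule tendsto_sandwich[of "\<lambda>_. 0" _ _ "\<lambda>m. (1 / 2) ^ m"])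
    show "\<forall>\<^sub>F m in sequentially. t m / real (P m) \<le> (1 / 2) ^ m"
    proof (intro always_eventually allI)
      fix m
      have "t m / real (P m) \<le> 1 / 2 ^ m"
        using t01[of m] Pge[of m] by (intro frac_le) auto
      then show "t m / real (P m) \<le> (1 / 2) ^ m" by (simp add: power_one_over)
    qed
    show "(\<lambda>m. (1 / 2 :: real) ^ m) \<longlonglongrightarrow> 0" by (rule LIMSEQ_power_zero) simp
  qed (use t01 in auto)
  have "(\<lambda>m. \<Sum>j<m. real_of_int (E (Suc j)) / real (P (Suc j))) \<longlonglongrightarrow> t 0 - 0"
    unfolding part by (intro tendsto_diff lim tendsto_const)
  moreover have "t 0 = x - real_of_int (E 0)" by (simp add: t_def P_def E_def frac_def)
  ultimately have "(\<lambda>n. real_of_int (E (Suc n)) / real (P (Suc n))) sums (x - real_of_int (E 0))"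
    unfolding sums_def by simp
  moreover have "\<forall>n\<ge>1. 0 \<le> E n \<and> E n \<le> int (Q n) - 1"
    using dig by (metis One_nat_def Suc_le_D)
  moreover have "E 0 = \<lfloor>x\<rfloor>" by (simp add: E_def)
  ultimately show ?thesis using inf unfolding is_cantor_expansion_def P_def by blast
qed

theorem cantor_expansion_ex1:
  assumes "basic_sequence Q"
  shows "\<exists>!E. is_cantor_expansion Q x E"
proof (rule ex_ex1I)
  show "\<exists>E. is_cantor_expansion Q x E" using cantor_expansion_exists[OF assms] .
next
  fix E E'
  assume E: "is_cantor_expansion Q x E" "is_cantor_expansion Q x E'"
  show "E = E'"
  proof
    fix n
    show "E n = E' n"
    proof (cases "n = 0")
      case True
      then show ?thesis using E by (simp add: is_cantor_expansion_def)
    next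
      case False
      then show ?thesis
        using cantor_expansion_floor[OF assms E(1)] cantor_expansion_floor[OF assms E(2)] by simp
    qed
  qed
qed

end

theory Submission imports Defs "HOL-Library.Infinite_Set" begin

text \<open>
  Fix \<open>x\<close> and \<open>g\<close>. When every \<open>q\<^sub>n\<close> is a power of \<open>g\<close>, the Cantor expansion only regroups the
  base-\<open>g\<close> digits of \<open>x\<close>: choosing the \<open>k\<^sub>n\<close> means choosing increasing cut positions
  \<open>K\<^sub>n = k\<^sub>1 + \<dots> + k\<^sub>n\<close>, and the shifts \<open>T\<^sub>n(x)\<close> are the fractional parts of \<open>g\<^bsup>K\<^sub>n\<^esup> x\<close>. By the
  pigeonhole principle some two-digit word occurs in the base-\<open>g\<close> expansion at infinitely many
  positions. Let the cuts alternate: jump to such a position, then read the single digit there, that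
  is, take \<open>q\<^sub>n = g\<close>. Every other shift then lies in one interval of length \<open>1 / g^2 \<le> 1 / 4\<close>, which
  rules out distribution normality. Moreover the first digit \<open>d\<close> of the word is the Cantor digit
  at every second place. If all jumps but the first have length at least \<open>2\<close>, then from there
  on a jump and the place after it together contribute at most \<open>1 / g + 1 / g^2 \<le> 3 / 4\<close> to the
  expected number of occurrences of \<open>d\<close>, while at least one occurrence is found; this rules out normality (\<open>ex_sequence_defeating\<close>).

  For the second claim, a number that is normal in base \<open>g\<close> and defeated by \<open>Q\<close> separates
  \<open>\<N>(g)\<close> from both sets at once. If on the other hand \<open>\<N>(g)\<close> were empty, it would suffice that
  both sets are nonempty for some \<open>Q\<close>, and this holds for \<open>q\<^sub>n = g^n\<close>. There the expected numbers of
  occurrences stay bounded, so that every number is \<open>Q\<close>-normal (\<open>Q_normal_powers\<close>). And the number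
  whose digit \<open>E\<^sub>n\<^sub>+\<^sub>1\<close> is the base-\<open>g\<close> reversal of \<open>n\<close> has shifts that follow the van der Corput
  sequence closely, and is therefore distribution normal (\<open>Q_distribution_normal_powers\<close>).
\<close>

section \<open>Cantor digits and shifts\<close>

lemma basic_sequence_prod_ge:
  assumes "basic_sequence Q"
  shows "real (\<Prod>i=1..n. Q i) \<ge> 2 ^ n"
proof (induction n)
  case (Suc n)
  have "real (Q (Suc n)) \<ge> 2"
    using assms by (simp add: basic_sequence_def)
  then have "2 ^ n * 2 \<le> real (\<Prod>i=1..n. Q i) * real (Q (Suc n))"
    using Suc by (intro mult_mono) (auto simp: prod_nonneg)
  then show ?case by (simp add: mult.commute)
qed simp

text \<open>
  The digits are differences of floors of consecutive multiples of \<open>x\<close>; removing the integer part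
  of the earlier multiple turns such a difference into a function of the shift alone. All later
  information about digits comes from this form.
\<close>

lemma cantor_expansion_digit_eq_floor_shift:
  assumes "basic_sequence Q" "is_cantor_expansion Q x E"
  shows "E (Suc n) = \<lfloor>real (Q (Suc n)) * cantor_shift Q n x\<rfloor>"
proof -
  define P where "P = real (\<Prod>i=1..n. Q i)"
  have "real (\<Prod>i=1..Suc n. Q i) * x = real (Q (Suc n)) * (P * x)"
    by (simp add: P_def mult_ac)
  also have "\<dots> = real (Q (Suc n)) * frac (P * x) + real_of_int (int (Q (Suc n)) * \<lfloor>P * x\<rfloor>)"
    by (simp add: frac_def algebra_simps)
  finally have "\<lfloor>real (\<Prod>i=1..Suc n. Q i) * x\<rfloor>
      = \<lfloor>real (Q (Suc n)) * frac (P * x)\<rfloor> + int (Q (Suc n)) * \<lfloor>P * x\<rfloor>"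
    by (simp only: floor_add_int)
  then show ?thesis
    using cantor_expansion_floor[OF assms, of "Suc n"]
    by (simp add: cantor_shift_def P_def)
qed

lemma cantor_digits_eq_floor_shift:
  assumes "basic_sequence Q"
  shows "cantor_digits Q x (Suc n) = \<lfloor>real (Q (Suc n)) * cantor_shift Q n x\<rfloor>"
  unfolding cantor_digits_def
  by (rule cantor_expansion_digit_eq_floor_shift[OF assms theI'[OF cantor_expansion_ex1[OF assms]]])

text \<open>
  The series of digits is dominated by the telescoping series of largest possible digits, whose sum
  is \<open>1\<close>. A single digit below the maximum makes the sum strictly less than \<open>1\<close>, as is needed for
  the integer part of the number to be \<open>0\<close>.
\<close>

lemma ex_real_with_cantor_digits:
  assumes Q: "basic_sequence Q"
    and D: "\<And>n. 0 \<le> D n \<and> D n \<le> int (Q (Suc n)) - 1"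
    and inf: "infinite {n. D n \<noteq> int (Q (Suc n)) - 1}"
  obtains x where "\<And>n. \<lfloor>real (Q (Suc n)) * cantor_shift Q n x\<rfloor> = D n"
proof -
  define P where "P n = real (\<Prod>i=1..n. Q i)" for n
  have PS: "P (Suc n) = P n * real (Q (Suc n))" for n by (simp add: P_def)
  have Pge: "P n \<ge> 2 ^ n" for n
    unfolding P_def by (rule basic_sequence_prod_ge[OF Q])
  have Ppos: "P n > 0" for n
    by (rule less_le_trans[OF _ Pge]) simp
  define a where "a n = real_of_int (D n) / P (Suc n)" for n
  define b where "b n = 1 / P n - 1 / P (Suc n)" for n
  have b_eq: "b n = (real (Q (Suc n)) - 1) / P (Suc n)" for n
  proof -
    have "Q (Suc n) > 0" using Ppos[of "Suc n"] by (simp add: PS zero_less_mult_iff)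
    then show ?thesis using Ppos[of n] by (simp add: b_def PS field_simps)
  qed
  have "(\<lambda>n. 1 / P n) \<longlonglongrightarrow> 0"
  proof (rule tendsto_sandwich[of "\<lambda>_. 0" _ _ "\<lambda>n. (1 / 2) ^ n"])
    show "\<forall>\<^sub>F n in sequentially. 1 / P n \<le> (1 / 2) ^ n"
      using Pge by (intro always_eventually allI) (simp add: power_one_over frac_le)
    show "(\<lambda>n. (1 / 2 :: real) ^ n) \<longlonglongrightarrow> 0" by (rule LIMSEQ_power_zero) simp
  qed (use Ppos in \<open>auto simp: less_imp_le\<close>)
  from telescope_sums'[OF this] have b_sums: "b sums 1"
    by (simp add: b_def[abs_def], simp add: P_def)
  have ab: "0 \<le> a n" "a n \<le> b n" for n
  proof -
    show "0 \<le> a n" using D[of n] Ppos[of "Suc n"] by (simp add: a_def)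
    have "real_of_int (D n) \<le> real (Q (Suc n)) - 1" using D[of n] by linarith
    then show "a n \<le> b n" 
      unfolding a_def b_eq using Ppos[of "Suc n"] by (intro divide_right_mono) auto
  qed
  have a_summable: "summable a"
    by (rule summable_comparison_test'[OF sums_summable[OF b_sums], of 0]) (use ab in auto)
  have "{n. D n \<noteq> int (Q (Suc n)) - 1} \<noteq> {}" using inf by (metis finite.emptyI)
  then obtain l where "D l \<noteq> int (Q (Suc l)) - 1" by blast
  then have "real_of_int (D l) < real (Q (Suc l)) - 1" using D[of l] by linarith
  then have l: "a l < b l"
    unfolding a_def b_eq using Ppos[of "Suc l"] by (intro divide_strict_right_mono) auto
  define x where "x = (\<Sum>n. a n)"
  have "0 < (\<Sum>n. b n - a n)"
    using ab l by (intro suminf_pos2[OF summable_diff[OF sums_summable[OF b_sums] a_summable], of l])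
      auto
  also have "\<dots> = 1 - x"
    using suminf_diff[OF sums_summable[OF b_sums] a_summable] sums_unique[OF b_sums]
    by (simp add: x_def)
  finally have "x < 1" by simp
  moreover have "0 \<le> x" unfolding x_def by (intro suminf_nonneg a_summable ab)
  ultimately have x0: "\<lfloor>x\<rfloor> = 0" by (simp add: floor_eq_iff)
  define E where "E n = (case n of 0 \<Rightarrow> 0 | Suc m \<Rightarrow> D m)" for n
  have "infinite (Suc ` {n. D n \<noteq> int (Q (Suc n)) - 1})"
    using inf by (simp add: finite_image_iff)
  moreover have "Suc ` {n. D n \<noteq> int (Q (Suc n)) - 1} \<subseteq> {n. n \<ge> 1 \<and> E n \<noteq> int (Q n) - 1}"
    by (auto simp: E_def)
  ultimately have "infinite {n. n \<ge> 1 \<and> E n \<noteq> int (Q n) - 1}"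
    using finite_subset by blast
  moreover have "\<forall>n\<ge>1. 0 \<le> E n \<and> E n \<le> int (Q n) - 1"
    using D by (auto simp: E_def split: nat.split)
  moreover have "a sums x" unfolding x_def using a_summable by (rule summable_sums)
  ultimately have "is_cantor_expansion Q x E"
    unfolding is_cantor_expansion_def using x0 by (simp add: E_def a_def[abs_def] P_def)
  from cantor_expansion_digit_eq_floor_shift[OF Q this] that[of x]
  show ?thesis by (simp add: E_def)
qed

lemma basic_sequence_powers:
  fixes g :: nat
  assumes "g \<ge> 2" "\<And>n. n \<ge> 1 \<Longrightarrow> k n \<ge> 1"
  shows "basic_sequence (\<lambda>n. g ^ k n)"
  unfolding basic_sequence_def
proof (intro allI impI)
  fix n :: nat assume "n \<ge> 1"
  then have "g \<le> g ^ k n" using assms(1) assms(2)[of n] by (intro self_le_power) auto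
  then show "2 \<le> g ^ k n" using assms(1) by linarith
qed

section \<open>Sequences of powers defeating a given number\<close>

text \<open>
  The cut positions are \<open>m\<^sub>0, m\<^sub>0 + 1, m\<^sub>1, m\<^sub>1 + 1, \<dots>\<close>, where the \<open>m\<^sub>i\<close> are places at which the
  same word of two base-\<open>g\<close> digits begins. Two digits, rather than one, are fixed for the sake of
  \<open>g = 2\<close>: half of the shifts lie in the cell of the word, and a cell of length \<open>1 / 2\<close> would give no
  contradiction.
\<close>

lemma ex_sequence_defeating:
  fixes x :: real and g :: nat
  assumes g: "g \<ge> 2"
  obtains Q k where "basic_sequence Q" "\<forall>n\<ge>1. k n \<ge> 1 \<and> Q n = g ^ k n"
    "x \<notin> Q_normal Q" "x \<notin> Q_distribution_normal Q"
proof -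
  \<comment> \<open>The digits at places \<open>m + 1\<close> and \<open>m + 2\<close>, read as one two-digit number.\<close>
  define f where "f m = nat \<lfloor>real g ^ 2 * frac (real g ^ m * x)\<rfloor>" for m
  have f_int: "int (f m) = \<lfloor>real g ^ 2 * frac (real g ^ m * x)\<rfloor>" for m
    by (simp add: f_def)
  have f_lt: "f m < g ^ 2" for m
  proof -
    have "real g ^ 2 * frac (real g ^ m * x) < real g ^ 2 * 1"
      using g by (intro mult_strict_left_mono frac_lt_1) auto
    then have "\<lfloor>real g ^ 2 * frac (real g ^ m * x)\<rfloor> < int (g ^ 2)"
      by (simp add: floor_less_iff)
    then show ?thesis using f_int[of m] by linarith
  qed
  have "finite (range f)"
    by (rule finite_subset[of _ "{..<g ^ 2}"]) (use f_lt in auto)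
  then obtain w where w: "w \<in> range f" and M_inf: "infinite (f -` {w})"
    by (rule inf_img_fin_domE) auto
  define M where "M = f -` {w}"
  \<comment> \<open>Keeping every third occurrence gives jumps of length at least \<open>2\<close>; dropping the occurrence
    of index \<open>0\<close> gives \<open>m 0 > 0\<close>, so that the first jump is not empty.\<close>
  define m where "m i = enumerate M (3 * i + 1)" for i
  have "infinite M" using M_inf by (simp add: M_def)
  have mono: "strict_mono (enumerate M)"
    using \<open>infinite M\<close> by (rule strict_mono_enumerate)
  have m0: "m 0 \<ge> 1"
    using strict_mono_imp_increasing[OF mono, of 1] by (simp add: m_def)
  have m_Suc: "m (Suc i) \<ge> m i + 3" for i
  proof -
    have "enumerate M j < enumerate M (Suc j)" for j
      using mono by (simp add: strict_mono_Suc_iff)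
    from this[of "3 * i + 1"] this[of "3 * i + 2"] this[of "3 * i + 3"]
    show ?thesis by (simp add: m_def eval_nat_numeral)
  qed
  have f_m: "f (m i) = w" for i
    using enumerate_in_set[OF \<open>infinite M\<close>] by (simp add: m_def M_def)
  define K where "K n = (if n = 0 then 0 else m ((n - 1) div 2) + (n - 1) mod 2)" for n
  define k where "k n = K n - K (n - 1)" for n
  define Q where "Q n = g ^ k n" for n
  have K_odd: "K (Suc (2 * i)) = m i" and K_even: "K (Suc (Suc (2 * i))) = m i + 1" for i
    by (simp_all add: K_def)
  have parity: "n = 0 \<or> (\<exists>i. n = Suc (2 * i)) \<or> (\<exists>i. n = Suc (Suc (2 * i)))" for n :: nat
    by presburger
  have K_less: "K n < K (Suc n)" for n
  proof -
    consider "n = 0" | i where "n = Suc (2 * i)" | i where "n = Suc (Suc (2 * i))"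
      using parity[of n] by blast
    then show ?thesis
    proof cases
      case 1
      then show ?thesis using m0 by (simp add: K_def)
    next
      case 2
      then show ?thesis by (simp add: K_odd K_even)
    next
      case (3 i)
      then show ?thesis using m_Suc[of i] K_odd[of "Suc i"] by (simp add: K_even)
    qed
  qed
  have k_pos: "k n \<ge> 1" if "n \<ge> 1" for n
    using K_less[of "n - 1"] that by (simp add: k_def)
  have k_even: "k (Suc (Suc (2 * i))) = 1" for i
    by (simp add: k_def K_odd K_even)
  have k_odd: "k (Suc (Suc (Suc (2 * i)))) \<ge> 2" for i
    using K_odd[of "Suc i"] m_Suc[of i] by (simp add: k_def K_even)
  have basic: "basic_sequence Q"
    unfolding Q_def[abs_def] using g k_pos by (rule basic_sequence_powers)
  have prod_Q: "(\<Prod>i=1..n. Q i) = g ^ K n" for n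
  proof (induction n)
    case (Suc n)
    have "K n + k (Suc n) = K (Suc n)" using K_less[of n] by (simp add: k_def)
    then show ?case using Suc by (simp add: Q_def flip: power_add)
  qed (simp add: K_def)
  have shift: "cantor_shift Q n x = frac (real g ^ K n * x)" for n
    unfolding cantor_shift_def prod_Q by simp

  have shift_odd: "frac (cantor_shift Q (Suc (2 * i)) x) \<in> {w / g ^ 2..<(w + 1) / g ^ 2}" for i
  proof -
    have "int w = \<lfloor>real g ^ 2 * cantor_shift Q (Suc (2 * i)) x\<rfloor>"
      using f_int[of "m i"] by (simp add: f_m shift K_odd)
    then have "real w \<le> real g ^ 2 * cantor_shift Q (Suc (2 * i)) x"
      "real g ^ 2 * cantor_shift Q (Suc (2 * i)) x < real w + 1"
      by linarith+
    moreover have "frac (cantor_shift Q (Suc (2 * i)) x) = cantor_shift Q (Suc (2 * i)) x"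
      by (simp add: cantor_shift_def)
    ultimately show ?thesis using g by (simp add: field_simps)
  qed
  have not_DN: "x \<notin> Q_distribution_normal Q"
  proof
    assume "x \<in> Q_distribution_normal Q"
    then have ud: "uniformly_distributed_mod1 (\<lambda>n. cantor_shift Q n x)"
      by (simp add: Q_distribution_normal_def)
    define A where
      "A N = {n. n < N \<and> frac (cantor_shift Q n x) \<in> {w / g ^ 2..<(w + 1) / g ^ 2}}" for N
    have "w < g ^ 2" using f_lt[of "m 0"] by (simp add: f_m)
    then have "real w + 1 \<le> real g ^ 2"
      by (metis Suc_leI of_nat_Suc of_nat_le_iff of_nat_power add.commute)
    then have "0 \<le> w / real g ^ 2 \<and> w / real g ^ 2 < (w + 1) / real g ^ 2 \<and> (w + 1) / real g ^ 2 \<le> 1"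
      using g by (auto simp: divide_strict_right_mono)
    then have "(\<lambda>N. real (card (A N)) / real N) \<longlonglongrightarrow> (w + 1) / real g ^ 2 - w / real g ^ 2"
      using ud unfolding uniformly_distributed_mod1_def A_def by fastforce
    moreover have "filterlim (\<lambda>N. 2 * Suc N) sequentially sequentially"
      by (rule filterlim_subseq) (simp add: strict_mono_Suc_iff)
    ultimately have "(\<lambda>N. real (card (A (2 * Suc N))) / real (2 * Suc N))
        \<longlonglongrightarrow> (w + 1) / real g ^ 2 - w / real g ^ 2"
      by (rule filterlim_compose)
    moreover have "1 / 2 \<le> real (card (A (2 * Suc N))) / real (2 * Suc N)" for N
    proof -
      have "(\<lambda>i. Suc (2 * i)) ` {..<Suc N} \<subseteq> A (2 * Suc N)"
        using shift_odd by (auto simp: A_def)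
      moreover have "finite (A (2 * Suc N))" by (simp add: A_def)
      ultimately have "card ((\<lambda>i. Suc (2 * i)) ` {..<Suc N}) \<le> card (A (2 * Suc N))"
        by (rule card_mono[rotated])
      then have "Suc N \<le> card (A (2 * Suc N))"
        by (simp add: card_image inj_on_def)
      then show ?thesis by (simp add: field_simps)
    qed
    ultimately have "1 / 2 \<le> (w + 1) / real g ^ 2 - w / real g ^ 2"
      by (intro LIMSEQ_le_const) auto
    also have "\<dots> = 1 / real g ^ 2" by (simp add: diff_divide_distrib[symmetric])
    also have "\<dots> \<le> 1 / 2 ^ 2"
      using g by (intro divide_left_mono power_mono) auto
    finally show False by simp
  qed

  \<comment> \<open>The first of the two digits of the word; it is the digit read between the cuts \<open>m i\<close> and
    \<open>m i + 1\<close>.\<close>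
  define d where "d = w div g"
  have "d < g"
    using f_lt[of "m 0"] g by (simp add: f_m d_def power2_eq_square less_mult_imp_div_less)
  have digit_even: "cantor_digits Q x (Suc (Suc (2 * i))) = int d" for i
  proof -
    have "cantor_digits Q x (Suc (Suc (2 * i))) = \<lfloor>real g * frac (real g ^ m i * x)\<rfloor>"
      using cantor_digits_eq_floor_shift[OF basic] by (simp add: Q_def k_even shift K_odd)
    also have "real g * frac (real g ^ m i * x)
        = (real g ^ 2 * frac (real g ^ m i * x)) / real_of_int (int g)"
      using g by (simp add: power2_eq_square)
    also have "\<lfloor>\<dots>\<rfloor> = \<lfloor>real g ^ 2 * frac (real g ^ m i * x)\<rfloor> div int g"
      by (rule floor_divide_real_eq_div) simp
    also have "\<dots> = int d" using f_int[of "m i"] by (simp add: f_m d_def zdiv_int)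
    finally show ?thesis .
  qed
  define W where "W j = of_bool (d < Q j) / real (Q j)" for j
  have weight: "block_weight Q n [d] = (\<Sum>j=1..n. W j)" for n
    by (simp add: block_weight_def block_admissible_def W_def)
  have W_even: "W (Suc (Suc (2 * i))) = 1 / g" for i
    using \<open>d < g\<close> by (simp add: W_def Q_def k_even)
  have W_le: "W (Suc j) \<le> 1 / real (Q (Suc j))" for j
    by (auto simp: W_def)
  have W_odd: "W (Suc (Suc (Suc (2 * i)))) \<le> 1 / 4" for i
  proof -
    have "(2::real) ^ 2 \<le> real g ^ 2" using g by (intro power_mono) auto
    also have "\<dots> \<le> real g ^ k (Suc (Suc (Suc (2 * i))))"
      using g k_odd by (intro power_increasing) auto
    finally have "4 \<le> real (Q (Suc (Suc (Suc (2 * i)))))" by (simp add: Q_def)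
    then have "1 / real (Q (Suc (Suc (Suc (2 * i))))) \<le> 1 / 4"
      by (intro divide_left_mono) auto
    then show ?thesis using W_le order_trans by blast
  qed
  have W_1: "W (Suc 0) \<le> 1 / 2"
  proof -
    have "Q (Suc 0) \<ge> 2" using basic by (simp add: basic_sequence_def)
    then have "1 / real (Q (Suc 0)) \<le> 1 / 2" by (intro divide_left_mono) auto
    then show ?thesis using W_le order_trans by blast
  qed
  have W_half: "W (Suc (Suc (2 * i))) \<le> 1 / 2" for i
    unfolding W_even using g by (intro divide_left_mono) auto
  have W_nonneg: "W j \<ge> 0" for j by (simp add: W_def)
  \<comment> \<open>The first jump may have length \<open>1\<close>, so its weight is bounded by \<open>1 / 2\<close> only; the additive
    constant accounts for the excess over \<open>1 / 4\<close>.\<close>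
  have weight_le: "block_weight Q (2 * Suc N) [d] \<le> 3 / 4 * real (Suc N) + 1 / 4" for N
  proof (induction N)
    case 0
    then show ?case using W_1 W_half[of 0] by (simp add: weight eval_nat_numeral)
  next
    case (Suc N)
    have "block_weight Q (2 * Suc (Suc N)) [d]
        = block_weight Q (2 * Suc N) [d] + W (Suc (2 * Suc N)) + W (Suc (Suc (2 * Suc N)))"
      by (simp add: weight)
    moreover have "W (Suc (2 * Suc N)) \<le> 1 / 4" "W (Suc (Suc (2 * Suc N))) \<le> 1 / 2"
      using W_odd[of N] W_half[of "Suc N"] by simp_all
    ultimately show ?case using Suc by (simp only: of_nat_Suc) argo
  qed
  have weight_ge: "block_weight Q n [d] \<ge> real (n div 2) / g" for n
  proof -
    have "(\<Sum>j\<in>(\<lambda>i. Suc (Suc (2 * i))) ` {..<n div 2}. W j) \<le> (\<Sum>j=1..n. W j)"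
      using W_nonneg by (intro sum_mono2) auto
    moreover have "(\<Sum>j\<in>(\<lambda>i. Suc (Suc (2 * i))) ` {..<n div 2}. W j) = real (n div 2) / g"
      by (subst sum.reindex) (auto simp: inj_on_def W_even)
    ultimately show ?thesis by (simp add: weight)
  qed
  have weight_at_top: "filterlim (\<lambda>n. block_weight Q n [d]) at_top sequentially"
  proof -
    have "filterlim (\<lambda>n. real n * (1 / g)) at_top sequentially"
      using g by (intro filterlim_at_top_mult_tendsto_pos[OF tendsto_const])
        (auto simp: filterlim_real_sequentially)
    moreover have "filterlim (\<lambda>n::nat. n div 2) sequentially sequentially"
      unfolding filterlim_at_top eventually_sequentially
      by (metis div_le_mono nonzero_mult_div_cancel_left zero_neq_numeral)
    ultimately have "filterlim (\<lambda>n. real (n div 2) * (1 / g)) at_top sequentially"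
      by (rule filterlim_compose)
    then show ?thesis
      by (rule filterlim_at_top_mono) (use weight_ge in auto)
  qed
  have count_ge: "block_count Q (2 * Suc N) [d] x \<ge> Suc N" for N
  proof -
    have "(\<lambda>i. Suc (Suc (2 * i))) ` {..<Suc N} \<subseteq>
        {j. 1 \<le> j \<and> j + length [d] \<le> 2 * Suc N + 1 \<and>
            (\<forall>i<length [d]. cantor_digits Q x (j + i) = int ([d] ! i))}"
      using digit_even by auto
    moreover have "finite {j. 1 \<le> j \<and> j + length [d] \<le> 2 * Suc N + 1 \<and>
            (\<forall>i<length [d]. cantor_digits Q x (j + i) = int ([d] ! i))}"
      by (rule finite_subset[of _ "{..2 * Suc N}"]) auto
    ultimately have "card ((\<lambda>i. Suc (Suc (2 * i))) ` {..<Suc N}) \<le> block_count Q (2 * Suc N) [d] x"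
      unfolding block_count_def by (rule card_mono[rotated])
    then show ?thesis by (simp add: card_image inj_on_def)
  qed
  have not_N: "x \<notin> Q_normal Q"
  proof
    assume "x \<in> Q_normal Q"
    then have "(\<lambda>n. real (block_count Q n [d] x) / block_weight Q n [d]) \<longlonglongrightarrow> 1"
      using weight_at_top by (simp add: Q_normal_def)
    moreover have "filterlim (\<lambda>N. 2 * Suc (Suc N)) sequentially sequentially"
      by (rule filterlim_subseq) (simp add: strict_mono_Suc_iff)
    ultimately have "(\<lambda>N. real (block_count Q (2 * Suc (Suc N)) [d] x)
        / block_weight Q (2 * Suc (Suc N)) [d]) \<longlonglongrightarrow> 1"
      by (rule filterlim_compose)
    \<comment> \<open>After \<open>2 * M\<close> digits the ratio is at least \<open>M / (3 * M / 4 + 1 / 4)\<close>, which equals \<open>8 / 7\<close>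
      at \<open>M = 2\<close> and increases with \<open>M\<close>.\<close>
    moreover have "8 / 7 \<le> real (block_count Q (2 * Suc (Suc N)) [d] x)
        / block_weight Q (2 * Suc (Suc N)) [d]" for N
    proof -
      have "0 < real (2 * Suc (Suc N) div 2) / g" using g by simp
      then have "block_weight Q (2 * Suc (Suc N)) [d] > 0"
        using weight_ge less_le_trans by blast
      moreover have "real (Suc (Suc N)) \<le> real (block_count Q (2 * Suc (Suc N)) [d] x)"
        using count_ge[of "Suc N"] of_nat_mono by blast
      moreover have "8 / 7 * block_weight Q (2 * Suc (Suc N)) [d] \<le> real (Suc (Suc N))"
      proof -
        have "8 / 7 * w \<le> real (Suc (Suc N))" if "w \<le> 3 / 4 * real (Suc (Suc N)) + 1 / 4" for w
          using that by (simp add: field_simps)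
        then show ?thesis using weight_le[of "Suc N"] .
      qed
      ultimately show ?thesis by (simp add: pos_le_divide_eq)
    qed
    ultimately have "8 / 7 \<le> (1::real)" by (intro LIMSEQ_le_const) auto
    then show False by simp
  qed
  show ?thesis
    using that[of Q k] basic k_pos not_N not_DN by (simp add: Q_def)
qed

section \<open>Uniform distribution from radix cells\<close>

text \<open>
  Up to \<open>N\<close> a residue class modulo \<open>G\<close> is met \<open>N / G\<close> times with an error below \<open>2\<close>, and finitely
  many exceptions change the count by a bounded amount.
\<close>

lemma frequency_residue_class:
  fixes G c n0 :: nat
  assumes "c < G" and P: "\<And>n. n \<ge> n0 \<Longrightarrow> P n \<longleftrightarrow> n mod G = c"
  shows "(\<lambda>N. real (card {n. n < N \<and> P n}) / real N) \<longlonglongrightarrow> 1 / real G"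
proof -
  have "\<bar>real (card {n. n < N \<and> P n}) - real N / G\<bar> \<le> n0 + 1" for N
  proof -
    define A where "A = {n. n < N \<and> P n}"
    define B where "B = {n. n < N \<and> n mod G = c}"
    have fin: "finite A" "finite B" by (simp_all add: A_def B_def)
    have "A \<subseteq> B \<union> {..<n0}" "B \<subseteq> A \<union> {..<n0}"
      using P by (auto simp: A_def B_def not_less)
    then have "card A \<le> card (B \<union> {..<n0})" "card B \<le> card (A \<union> {..<n0})"
      using fin by (auto intro!: card_mono)
    then have AB: "card A \<le> card B + n0" "card B \<le> card A + n0"
      using card_Un_le[of B "{..<n0}"] card_Un_le[of A "{..<n0}"] by auto
    have inj: "inj_on (\<lambda>i. i * G + c) I" for I
      using assms(1) by (auto simp: inj_on_def)
    have "(\<lambda>i. i * G + c) ` {..<N div G} \<subseteq> B"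
    proof safe
      fix i assume "i < N div G"
      then have "Suc i * G \<le> N" by (metis Suc_leI div_times_less_eq_dividend le_trans mult_le_mono1)
      then show "i * G + c \<in> B" using assms(1) by (simp add: B_def)
    qed
    from card_mono[OF fin(2) this] have lo: "N div G \<le> card B"
      by (simp add: card_image inj)
    have "B \<subseteq> (\<lambda>i. i * G + c) ` {..N div G}"
    proof
      fix n assume n: "n \<in> B"
      then have "n = n div G * G + c" by (metis (mono_tags) B_def div_mult_mod_eq mem_Collect_eq)
      moreover have "n div G \<le> N div G" using n by (intro div_le_mono) (simp add: B_def)
      ultimately show "n \<in> (\<lambda>i. i * G + c) ` {..N div G}" by blast
    qed
    from card_mono[OF _ this] have hi: "card B \<le> N div G + 1"
      by (simp add: card_image inj)
    have "real N / G = real (N div G) + real (N mod G) / G"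
    proof -
      have "real N = real (N div G) * real G + real (N mod G)"
        by (simp flip: of_nat_mult of_nat_add)
      then show ?thesis using assms(1) by (simp add: field_simps)
    qed
    moreover have "0 \<le> real (N mod G) / G" "real (N mod G) / G \<le> 1"
      using assms(1) by (auto simp: less_imp_le)
    ultimately show ?thesis using lo hi AB unfolding A_def[symmetric] by linarith
  qed
  note bound = this
  have "(\<lambda>N. real (card {n. n < N \<and> P n}) / real N - 1 / G) \<longlonglongrightarrow> 0"
  proof (rule tendsto_0_le[where K = 1])
    show "\<forall>\<^sub>F N in sequentially.
        norm (real (card {n. n < N \<and> P n}) / real N - 1 / G) \<le> norm ((real n0 + 1) / real N) * 1"
    proof (rule eventually_sequentiallyI[of 1])
      fix N :: nat assume "N \<ge> 1"
      then have "real (card {n. n < N \<and> P n}) / real N - 1 / G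
          = (real (card {n. n < N \<and> P n}) - real N / G) / real N"
        by (simp add: field_simps)
      then show "norm (real (card {n. n < N \<and> P n}) / real N - 1 / G)
          \<le> norm ((real n0 + 1) / real N) * 1"
        using bound[of N] by (simp add: divide_right_mono)
    qed
    show "(\<lambda>N. (real n0 + 1) / real N) \<longlonglongrightarrow> 0"
      by (rule lim_const_over_n)
  qed
  then show ?thesis by (simp add: LIM_zero_iff)
qed

text \<open>
  Inside \<open>[a, b)\<close> lie at least \<open>(b - a) g^k - 2\<close> of the cells \<open>[c / g^k, (c + 1) / g^k)\<close>, and at most
  \<open>(b - a) g^k + 2\<close> cells cover it. Hence the frequency of \<open>[a, b)\<close> is asymptotically within
  \<open>2 / g^k\<close> of \<open>b - a\<close>, for every \<open>k\<close>.
\<close>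

lemma uniformly_distributed_mod1_if_radix_cells:
  fixes g :: nat
  assumes g: "g \<ge> 2"
    and cells: "\<And>k c. c < g ^ k \<Longrightarrow>
      (\<lambda>N. real (card {n. n < N \<and> \<lfloor>real g ^ k * frac (s n)\<rfloor> = int c}) / real N)
        \<longlonglongrightarrow> 1 / real g ^ k"
  shows "uniformly_distributed_mod1 s"
  unfolding uniformly_distributed_mod1_def
proof (intro allI impI)
  fix a b :: real
  assume ab: "0 \<le> a \<and> a < b \<and> b \<le> 1"
  define A where "A N = {n. n < N \<and> frac (s n) \<in> {a..<b}}" for N
  define cell where "cell k N c = {n. n < N \<and> \<lfloor>real g ^ k * frac (s n)\<rfloor> = c}" for k N and c :: int
  have cells': "(\<lambda>N. real (card (\<Union>c\<in>C. cell k N c)) / real N) \<longlonglongrightarrow> real (card C) / real g ^ k"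
    if C: "C \<subseteq> {0..<int (g ^ k)}" for k C
  proof -
    have fin: "finite C" using C by (rule finite_subset) simp
    have "card (\<Union>c\<in>C. cell k N c) = (\<Sum>c\<in>C. card (cell k N c))" for N
      using fin by (intro card_UN_disjoint) (auto simp: cell_def)
    then have "(\<lambda>N. real (card (\<Union>c\<in>C. cell k N c)) / real N)
        = (\<lambda>N. \<Sum>c\<in>C. real (card (cell k N c)) / real N)"
      by (simp add: sum_divide_distrib)
    moreover have "(\<lambda>N. real (card (cell k N c)) / real N) \<longlonglongrightarrow> 1 / real g ^ k" if "c \<in> C" for c
      using cells[of "nat c" k] that C unfolding cell_def by (auto simp: nat_less_iff)
    then have "(\<lambda>N. \<Sum>c\<in>C. real (card (cell k N c)) / real N) \<longlonglongrightarrow> (\<Sum>c\<in>C. 1 / real g ^ k)"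
      by (rule tendsto_sum)
    ultimately show ?thesis by simp
  qed
  have small: "\<exists>k. 2 / real g ^ k < e" if "e > 0" for e :: real
  proof -
    obtain k where "2 / e < 2 ^ k" using real_arch_pow[of 2 "2 / e"] by auto
    also have "(2::real) ^ k \<le> real g ^ k" using g by (intro power_mono) auto
    finally show ?thesis using that g by (intro exI[of _ k]) (simp add: field_simps)
  qed
  have "(\<lambda>N. real (card (A N)) / real N) \<longlonglongrightarrow> b - a"
  proof (rule order_tendstoI)
    fix y assume "y < b - a"
    then obtain k where k: "2 / real g ^ k < b - a - y" using small[of "b - a - y"] by auto
    define G where "G = real g ^ k"
    have G: "G > 0" using g by (simp add: G_def)
    define C where "C = {\<lceil>a * G\<rceil>..<\<lfloor>b * G\<rfloor>}"
    have "b * G \<le> 1 * G" using ab G by (intro mult_right_mono) auto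
    then have "\<lfloor>b * G\<rfloor> \<le> int (g ^ k)" by (simp add: G_def floor_le_iff)
    moreover have "0 \<le> \<lceil>a * G\<rceil>" using ab G by (simp add: less_le_trans[of "-1" 0])
    ultimately have C: "C \<subseteq> {0..<int (g ^ k)}" by (auto simp: C_def)
    have "real (card C) \<ge> (b - a) * G - 2"
      unfolding C_def by (simp add: algebra_simps) linarith
    then have "real (card C) / G \<ge> ((b - a) * G - 2) / G"
      using G by (intro divide_right_mono) auto
    also have "((b - a) * G - 2) / G = b - a - 2 / G" using G by (simp add: field_simps)
    finally have "y < real (card C) / real g ^ k" using k by (simp add: G_def)
    from order_tendstoD(1)[OF cells'[OF C] this]
    show "\<forall>\<^sub>F N in sequentially. y < real (card (A N)) / real N"
    proof (rule eventually_mono)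
      fix N assume y: "y < real (card (\<Union>c\<in>C. cell k N c)) / real N"
      have "(\<Union>c\<in>C. cell k N c) \<subseteq> A N"
      proof safe
        fix c n assume "c \<in> C" "n \<in> cell k N c"
        then have "a * G \<le> G * frac (s n)" "G * frac (s n) < b * G" "n < N"
          unfolding C_def cell_def G_def by (auto simp: ceiling_le_iff less_floor_iff) linarith+
        then show "n \<in> A N" using G by (simp add: A_def mult.commute)
      qed
      then have "card (\<Union>c\<in>C. cell k N c) \<le> card (A N)"
        by (rule card_mono[rotated]) (simp add: A_def)
      then show "y < real (card (A N)) / real N"
        using y by (meson divide_right_mono less_le_trans of_nat_0_le_iff of_nat_mono)
    qed
  next
    fix y assume "y > b - a"
    then obtain k where k: "2 / real g ^ k < y - (b - a)" using small[of "y - (b - a)"] by auto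
    define G where "G = real g ^ k"
    have G: "G > 0" using g by (simp add: G_def)
    define C where "C = {\<lfloor>a * G\<rfloor>..<\<lceil>b * G\<rceil>}"
    have "b * G \<le> 1 * G" using ab G by (intro mult_right_mono) auto
    then have "\<lceil>b * G\<rceil> \<le> int (g ^ k)" by (simp add: G_def ceiling_le_iff)
    moreover have "0 \<le> \<lfloor>a * G\<rfloor>" using ab G by simp
    ultimately have C: "C \<subseteq> {0..<int (g ^ k)}" by (auto simp: C_def)
    have "a * G < b * G" using ab G by simp
    then have "real (card C) \<le> (b - a) * G + 2"
      unfolding C_def by (simp add: algebra_simps) linarith
    then have "real (card C) / G \<le> ((b - a) * G + 2) / G"
      using G by (intro divide_right_mono) auto
    also have "((b - a) * G + 2) / G = b - a + 2 / G" using G by (simp add: field_simps)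
    finally have "real (card C) / real g ^ k < y" using k by (simp add: G_def)
    from order_tendstoD(2)[OF cells'[OF C] this]
    show "\<forall>\<^sub>F N in sequentially. real (card (A N)) / real N < y"
    proof (rule eventually_mono)
      fix N assume y: "real (card (\<Union>c\<in>C. cell k N c)) / real N < y"
      have "A N \<subseteq> (\<Union>c\<in>C. cell k N c)"
      proof
        fix n assume n: "n \<in> A N"
        then have "a * G \<le> G * frac (s n)" "G * frac (s n) < b * G"
          using G by (auto simp: A_def mult.commute)
        then have "\<lfloor>G * frac (s n)\<rfloor> \<in> C"
          unfolding C_def by (auto intro: floor_mono) linarith
        then show "n \<in> (\<Union>c\<in>C. cell k N c)"
          using n by (auto simp: cell_def G_def A_def)
      qed
      then have "card (A N) \<le> card (\<Union>c\<in>C. cell k N c)"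
        by (rule card_mono[rotated])
          (rule finite_subset[of _ "{..<N}"], auto simp: cell_def)
      then show "real (card (A N)) / real N < y"
        using y by (meson divide_right_mono le_less_trans of_nat_0_le_iff of_nat_mono)
    qed
  qed
  then show "(\<lambda>N. real (card {n. n < N \<and> frac (s n) \<in> {a..<b}}) / real N) \<longlonglongrightarrow> b - a"
    by (simp add: A_def)
qed

section \<open>The bases \<open>g\<close>, \<open>g^2\<close>, \<open>g^3\<close>, \<dots>\<close>

text \<open>
  The last \<open>k\<close> base-\<open>g\<close> digits of \<open>n\<close>, written in reverse order. The quotient
  \<open>digit_reversal g k n / g^k\<close> tends, as \<open>k\<close> grows, to the \<open>n\<close>-th term of the van der Corput sequence.
\<close>

primrec digit_reversal :: "nat \<Rightarrow> nat \<Rightarrow> nat \<Rightarrow> nat" where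
  "digit_reversal g 0 n = 0"
| "digit_reversal g (Suc k) n = g * digit_reversal g k n + n div g ^ k mod g"

lemma digit_reversal_less:
  assumes "g > 0"
  shows "digit_reversal g k n < g ^ k"
proof (induction k)
  case (Suc k)
  have "n div g ^ k mod g < g" using assms by simp
  moreover have "g * Suc (digit_reversal g k n) \<le> g * g ^ k"
    using Suc by (intro mult_le_mono2) simp
  ultimately show ?case by simp
qed simp

lemma digit_reversal_div_power:
  assumes "g > 0"
  shows "digit_reversal g (k + j) n div g ^ j = digit_reversal g k n"
proof (induction j)
  case (Suc j)
  have "digit_reversal g (k + Suc j) n div g = digit_reversal g (k + j) n"
    using assms by simp
  then show ?case using Suc by (simp only: power_Suc div_mult2_eq)
qed simp

lemma digit_reversal_eq_iff:
  assumes "g > 0"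
  shows "digit_reversal g k m = digit_reversal g k n \<longleftrightarrow> m mod g ^ k = n mod g ^ k"
proof (induction k)
  case (Suc k)
  have split: "u = u' \<and> v = v'" if "g * u + v = g * u' + v'" "v < g" "v' < g" for u v u' v' :: nat
  proof -
    have "(g * u + v) div g = (g * u' + v') div g" "(g * u + v) mod g = (g * u' + v') mod g"
      using that(1) by simp_all
    then show ?thesis using assms that(2,3) by simp
  qed
  have r: "digit_reversal g (Suc k) m = digit_reversal g (Suc k) n \<longleftrightarrow>
      digit_reversal g k m = digit_reversal g k n \<and> m div g ^ k mod g = n div g ^ k mod g"
    using split[of "digit_reversal g k m" "m div g ^ k mod g"
        "digit_reversal g k n" "n div g ^ k mod g"] assms by auto
  have mods: "u mod g ^ Suc k = g ^ k * (u div g ^ k mod g) + u mod g ^ k" for u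
    by (simp only: power_Suc2 mod_mult2_eq)
  have "m mod g ^ Suc k = n mod g ^ Suc k \<longleftrightarrow>
      m mod g ^ k = n mod g ^ k \<and> m div g ^ k mod g = n div g ^ k mod g"
  proof
    assume eq: "m mod g ^ Suc k = n mod g ^ Suc k"
    have "u mod g ^ Suc k mod g ^ k = u mod g ^ k" for u
      by (simp add: mod_mod_cancel)
    then have "m mod g ^ k = n mod g ^ k" using eq by metis
    moreover from this have "g ^ k * (m div g ^ k mod g) = g ^ k * (n div g ^ k mod g)"
      using eq mods[of m] mods[of n] by simp
    ultimately show "m mod g ^ k = n mod g ^ k \<and> m div g ^ k mod g = n div g ^ k mod g"
      using assms by simp
  qed (simp only: mods)
  then show ?case using Suc r by simp
qed simp

text \<open>
  Reversal permutes the \<open>k\<close>-digit words. Prescribing the leading \<open>k\<close> digits of a van der Corput term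
  therefore selects exactly one residue class of indices modulo \<open>g^k\<close>.
\<close>

lemma digit_reversal_residue:
  assumes "g > 0" "c < g ^ k"
  obtains r where "r < g ^ k" "\<And>n. digit_reversal g k n = c \<longleftrightarrow> n mod g ^ k = r"
proof -
  have "inj_on (digit_reversal g k) {..<g ^ k}"
    using assms by (auto simp: inj_on_def digit_reversal_eq_iff)
  moreover have "digit_reversal g k ` {..<g ^ k} \<subseteq> {..<g ^ k}"
    using digit_reversal_less[OF assms(1)] by auto
  ultimately have "digit_reversal g k ` {..<g ^ k} = {..<g ^ k}"
    by (intro endo_inj_surj) auto
  then obtain r where "r < g ^ k" "digit_reversal g k r = c"
    using assms(2) by (metis imageE lessThan_iff)
  then show ?thesis
    using that[of r] digit_reversal_eq_iff[OF assms(1)] by (metis mod_less)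
qed

text \<open>
  A nonempty block starting at place \<open>j\<close> has weight at most \<open>1 / g^j\<close>. So no block has divergent
  weight, and the condition of \<open>Q\<close>-normality is vacuous.
\<close>

lemma Q_normal_powers:
  assumes g: "g \<ge> 2"
  shows "Q_normal (\<lambda>n. g ^ n) = UNIV"
proof -
  have bounded: "block_weight (\<lambda>n. g ^ n) n B \<le> 1" if "B \<noteq> []" for n B
  proof -
    have "block_weight (\<lambda>n. g ^ n) n B \<le> (\<Sum>j=1..n. (1 / 2) ^ j)"
      unfolding block_weight_def
    proof (intro sum_mono)
      fix j
      have "j \<in> {j..<j + length B}" using that by simp
      then have "g ^ j dvd (\<Prod>i=j..<j + length B. g ^ i)"
        by (intro dvd_prodI) auto
      then have "g ^ j \<le> (\<Prod>i=j..<j + length B. g ^ i)"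
        using g by (intro dvd_imp_le prod_pos) auto
      moreover have "2 ^ j \<le> g ^ j" using g by (rule power_mono) simp
      ultimately have "2 ^ j \<le> (\<Prod>i=j..<j + length B. g ^ i)" by (rule le_trans[rotated])
      then have le: "(2::real) ^ j \<le> real (\<Prod>i=j..<j + length B. g ^ i)"
        by (metis of_nat_le_iff of_nat_numeral of_nat_power)
      have "of_bool (block_admissible (\<lambda>n. g ^ n) j B) / real (\<Prod>i=j..<j + length B. g ^ i)
          \<le> 1 / 2 ^ j"
        using le by (intro frac_le) auto
      then show "of_bool (block_admissible (\<lambda>n. g ^ n) j B) / real (\<Prod>i=j..<j + length B. g ^ i)
          \<le> (1 / 2) ^ j" by (simp add: power_one_over)
    qed
    also have "(\<Sum>j=1..n. (1 / 2 :: real) ^ j) = 1 - (1 / 2) ^ n"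
      by (induction n) (auto simp: field_simps)
    also have "\<dots> \<le> 1" by simp
    finally show ?thesis .
  qed
  have "\<not> filterlim (\<lambda>n. block_weight (\<lambda>n. g ^ n) n B) at_top sequentially" if "B \<noteq> []" for B
  proof
    assume "filterlim (\<lambda>n. block_weight (\<lambda>n. g ^ n) n B) at_top sequentially"
    then have "\<forall>\<^sub>F n in sequentially. block_weight (\<lambda>n. g ^ n) n B > 1"
      by (simp add: filterlim_at_top_dense)
    then obtain n where "block_weight (\<lambda>n. g ^ n) n B > 1"
      by (auto simp: eventually_sequentially)
    then show False using bounded[OF that, of n] by simp
  qed
  then show ?thesis by (auto simp: Q_normal_def)
qed

text \<open>
  The witness has the \<open>n + 1\<close> digit reversal of \<open>n\<close> as its digit of index \<open>n + 1\<close>. For \<open>n \<ge> k\<close> the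
  first \<open>k\<close> base-\<open>g\<close> digits of its \<open>n\<close>-th shift are the leading digits of that reversal, hence they
  are determined by \<open>n\<close> modulo \<open>g^k\<close>, and every radix cell receives its correct frequency.
\<close>

lemma Q_distribution_normal_powers:
  assumes g: "g \<ge> 2"
  shows "Q_distribution_normal (\<lambda>n. g ^ n) \<noteq> {}"
proof -
  have g0: "g > 0" using g by simp
  define D where "D n = int (digit_reversal g (Suc n) n)" for n
  have basic: "basic_sequence (\<lambda>n. g ^ n)"
    using g by (rule basic_sequence_powers) simp
  have D_less: "D n < int (g ^ Suc n) - 1" for n
  proof -
    \<comment> \<open>\<open>n\<close> has at most \<open>n\<close> digits, so that its reversal in \<open>n + 1\<close> digits ends in \<open>0\<close>.\<close>
    have "n < g ^ n" using g by (intro power_gt_expt) simp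
    then have "digit_reversal g (Suc n) n = g * digit_reversal g n n" by simp
    moreover have "g * Suc (digit_reversal g n n) \<le> g * g ^ n"
      using digit_reversal_less[OF g0, of n n] by (intro mult_le_mono2) simp
    ultimately have "digit_reversal g (Suc n) n + 2 \<le> g ^ Suc n" using g by simp
    then show ?thesis unfolding D_def by linarith
  qed
  have "0 \<le> D n \<and> D n \<le> int (g ^ Suc n) - 1" for n
    using D_less[of n] by (simp add: D_def)
  moreover have "{n. D n \<noteq> int (g ^ Suc n) - 1} = UNIV"
    using less_imp_neq[OF D_less] by blast
  then have "infinite {n. D n \<noteq> int (g ^ Suc n) - 1}" by (simp only: infinite_UNIV_nat not_False_eq_True)
  ultimately obtain x where
    x: "\<And>n. \<lfloor>real (g ^ Suc n) * cantor_shift (\<lambda>n. g ^ n) n x\<rfloor> = D n"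
    by (rule ex_real_with_cantor_digits[OF basic]) blast
  define s where "s n = cantor_shift (\<lambda>n. g ^ n) n x" for n
  have frac_s: "frac (s n) = s n" for n by (simp add: s_def cantor_shift_def)
  have floor_s: "\<lfloor>real g ^ k * s n\<rfloor> = int (digit_reversal g k n)" if kn: "n \<ge> k" for n k
  proof -
    obtain j where j: "Suc n = k + j" using le_Suc_ex[OF le_SucI[OF kn]] by blast
    have "real g ^ k * s n = real (g ^ Suc n) * s n / real_of_int (int (g ^ j))"
      using g0 by (simp add: j power_add del: power_Suc)
    also have "\<lfloor>\<dots>\<rfloor> = \<lfloor>real (g ^ Suc n) * s n\<rfloor> div int (g ^ j)"
      by (rule floor_divide_real_eq_div) simp
    also have "\<dots> = int (digit_reversal g (k + j) n div g ^ j)"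
      using x[of n] by (simp only: s_def D_def zdiv_int flip: j)
    finally show ?thesis by (simp add: digit_reversal_div_power[OF g0])
  qed
  have "uniformly_distributed_mod1 s"
  proof (rule uniformly_distributed_mod1_if_radix_cells[OF g])
    fix k c assume "c < g ^ k"
    then obtain r where r: "r < g ^ k" "\<And>n. digit_reversal g k n = c \<longleftrightarrow> n mod g ^ k = r"
      using digit_reversal_residue[OF g0] by blast
    have "(\<lambda>N. real (card {n. n < N \<and> \<lfloor>real g ^ k * frac (s n)\<rfloor> = int c}) / real N)
        \<longlonglongrightarrow> 1 / real (g ^ k)"
      using r(1) by (rule frequency_residue_class[where ?n0.0 = k]) (simp add: frac_s floor_s r(2))
    then show "(\<lambda>N. real (card {n. n < N \<and> \<lfloor>real g ^ k * frac (s n)\<rfloor> = int c}) / real N)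
        \<longlonglongrightarrow> 1 / real g ^ k" by simp
  qed
  then have "x \<in> Q_distribution_normal (\<lambda>n. g ^ n)"
    by (simp add: Q_distribution_normal_def s_def[abs_def])
  then show ?thesis by blast
qed

section \<open>Separation of the sets of normal numbers\<close>

theorem theorem1p6:
  "(\<forall>(x::real) (g::nat). g \<ge> 2 \<longrightarrow>
      (\<exists>(Q::nat \<Rightarrow> nat) (k::nat \<Rightarrow> nat).
         basic_sequence Q \<and> (\<forall>n\<ge>1. k n \<ge> 1 \<and> Q n = g ^ k n) \<and>
         x \<notin> Q_normal Q \<union> Q_distribution_normal Q)) \<and>
   (\<forall>g::nat. g \<ge> 2 \<longrightarrow>
      (\<exists>(Q::nat \<Rightarrow> nat) (k::nat \<Rightarrow> nat).
         basic_sequence Q \<and> (\<forall>n\<ge>1. k n \<ge> 1 \<and> Q n = g ^ k n) \<and>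
         base_normal g \<noteq> Q_normal Q \<and> base_normal g \<noteq> Q_distribution_normal Q))"
proof (intro conjI allI impI)
  fix x :: real and g :: nat
  assume "g \<ge> 2"
  then show "\<exists>Q k. basic_sequence Q \<and> (\<forall>n\<ge>1. k n \<ge> 1 \<and> Q n = g ^ k n) \<and>
      x \<notin> Q_normal Q \<union> Q_distribution_normal Q"
    by (rule ex_sequence_defeating[where x = x]) blast
next
  fix g :: nat
  assume g: "g \<ge> 2"
  show "\<exists>Q k. basic_sequence Q \<and> (\<forall>n\<ge>1. k n \<ge> 1 \<and> Q n = g ^ k n) \<and>
      base_normal g \<noteq> Q_normal Q \<and> base_normal g \<noteq> Q_distribution_normal Q"
  proof (cases "base_normal g = {}")
    case True
    have "basic_sequence (\<lambda>n. g ^ n)"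
      using g by (rule basic_sequence_powers) simp
    then show ?thesis
      using True Q_normal_powers[OF g] Q_distribution_normal_powers[OF g]
      by (intro exI[of _ "\<lambda>n. g ^ n"] exI[of _ "\<lambda>n. n"]) auto
  next
    case False
    then obtain x where "x \<in> base_normal g" by blast
    from g show ?thesis
      by (rule ex_sequence_defeating[where x = x]) (use \<open>x \<in> base_normal g\<close> in blast)
  qed
qed

end
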